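(* Let $x=(\nu_1,\dots,\nu_8;\kappa_1,\kappa_2;f,g)$ and let $x'=(\nu'_1,\dots,\nu'_8;\kappa'_1,\kappa'_2;f',g')\in K^{12}$ be a tuple with $x'\sim x$, where $\sim$ is the equivalence of type $E_8^{(1)}$ given in the context. Then for each generator $w\in\{s_0,s_1,\dots,s_8\}$ of $\widetilde W(E_8^{(1)})$, the action of $w$ on $x'$ has the same form as its action on $x$ up to the equivalence; that is, writing $w(x)=R_w(x)$ with $R_w$ the explicit tuple of rational expressions defining $w$, $$\bigl(w(\nu'_1),\dots,w(\nu'_8);w(\kappa'_1),w(\kappa'_2);w(f'),w(g')\bigr)\sim R_w(\nu'_1,\dots,\nu'_8;\kappa'_1,\kappa'_2;f',g').$$
   Context: Let $K=\mathbb{C}(\nu_1,\dots,\nu_8,\kappa_1,\kappa_2,f,g)$ be the field of rational functions in 12 independent variables, and put $q=\kappa_1^2\kappa_2^2/(\nu_1\nu_2\cdots\nu_8)\in K$ (i.e. $\kappa_1^2\kappa_2^2=q\,\nu_1\cdots\nu_8$). Action of the generators of the affine Weyl group $\widetilde W(E_8^{(1)})=W(E_8^{(1)})$: the following are $\mathbb{C}$-algebra automorphisms of $K$; variables not mentioned are fixed. - $s_1:\ \kappa_1\leftrightarrow\kappa_2,\ f\leftrightarrow g$. - $s_0:\nu_1\leftrightarrow\nu_2$; $s_3:\nu_2\leftrightarrow\nu_3$; $s_4:\nu_3\leftrightarrow\nu_4$; $s_5:\nu_4\leftrightarrow\nu_5$; $s_6:\nu_5\leftrightarrow\nu_6$;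 $s_7:\nu_6\leftrightarrow\nu_7$; $s_8:\nu_7\leftrightarrow\nu_8$. - $s_2:\ \nu_1\to\frac{\kappa_2}{\nu_2},\ \nu_2\to\frac{\kappa_2}{\nu_1},\ \kappa_1\to\frac{\kappa_1\kappa_2}{\nu_1\nu_2}$, and $f\to N/D$ with $$N=\nu_1\nu_2(\kappa_1-\kappa_2)fg+\kappa_2(\nu_1+\nu_2)(\nu_1\nu_2-\kappa_1)f-\kappa_1(\nu_1+\nu_2)(\nu_1\nu_2-\kappa_2)g+(\kappa_1-\kappa_2)(\nu_1\nu_2-\kappa_1)(\nu_1\nu_2-\kappa_2),$$ $$D=\nu_1\nu_2(\nu_1\nu_2-\kappa_2)f-\nu_1\nu_2(\nu_1\nu_2-\kappa_1)g-\nu_1\nu_2(\nu_1+\nu_2)(\kappa_1-\kappa_2).$$ For each generator $w$, $R_w$ denotes the 12-tuple of rational expressions listed above giving $(w(\nu_1),\dots,w(\nu_8);w(\kappa_1),w(\kappa_2);w(f),w(g))$ in terms of $x$; $R_w(x')$ is obtained by substituting the entries of $x'$ for the corresponding variables. Equivalence of type $E_8^{(1)}$: two tuples $y'$ and $y=(\nu_1,\dots,\nu_8;\kappa_1,\kappa_2;f,g)$ with entries in $K$ satisfy $y'\sim y$ iff there exists $c\in K\setminus\{0\}$ such that $$y'=(c\nu_1,c\nu_2,\dots,c\nu_8;\ c^2\kappa_1,\ c^2\kappa_2;\ cf,\ cg)$$ (here $\nu_i,\kappa_i,f,g$ denote the entries of $y$, whatever elements of $K$ they are). *)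

theory Defs
  imports Complex_Main "HOL-Library.Poly_Mapping" "HOL-Computational_Algebra.Fraction_Field"
begin

datatype var = Nu1 | Nu2 | Nu3 | Nu4 | Nu5 | Nu6 | Nu7 | Nu8 | Kappa1 | Kappa2 | F | G

text \<open>
  The linear order on the variables has no mathematical significance: the library shows that a
  ring of \<open>poly_mapping\<close>s is an integral domain only for linearly ordered exponents.
\<close>

primrec var_rank :: "var \<Rightarrow> nat" where
  "var_rank Nu1 = 1"
| "var_rank Nu2 = 2"
| "var_rank Nu3 = 3"
| "var_rank Nu4 = 4"
| "var_rank Nu5 = 5"
| "var_rank Nu6 = 6"
| "var_rank Nu7 = 7"
| "var_rank Nu8 = 8"
| "var_rank Kappa1 = 9"
| "var_rank Kappa2 = 10"
| "var_rank F = 11"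
| "var_rank G = 12"

lemma var_rank_inject: "var_rank u = var_rank v \<Longrightarrow> u = v"
  by (cases u; cases v; simp)

instantiation var :: linorder
begin

definition less_eq_var :: "var \<Rightarrow> var \<Rightarrow> bool" where
  "u \<le> v \<longleftrightarrow> var_rank u \<le> var_rank v"

definition less_var :: "var \<Rightarrow> var \<Rightarrow> bool" where
  "u < v \<longleftrightarrow> var_rank u < var_rank v"

instance
  by standard (auto simp: less_eq_var_def less_var_def intro: var_rank_inject)

end

text \<open>
  A monomial is a finitely supported exponent vector \<open>var \<Rightarrow>\<^sub>0 nat\<close>, a polynomial a finitely
  supported family of complex coefficients indexed by monomials (with the convolution product),
  and \<open>K\<close> is the fraction field of the polynomial ring in the twelve variables.
\<close>

type_synonym K = "((var \<Rightarrow>\<^sub>0 nat) \<Rightarrow>\<^sub>0 complex) fract"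

definition const :: "complex \<Rightarrow> K" where
  "const a = Fract (Poly_Mapping.single 0 a) 1"

definition X :: "var \<Rightarrow> K" where
  "X v = Fract (Poly_Mapping.single (Poly_Mapping.single v 1) 1) 1"

definition C_algebra_automorphism :: "(K \<Rightarrow> K) \<Rightarrow> bool" where
  "C_algebra_automorphism \<sigma> \<longleftrightarrow>
     bij \<sigma> \<and>
     (\<forall>a b. \<sigma> (a + b) = \<sigma> a + \<sigma> b) \<and>
     (\<forall>a b. \<sigma> (a * b) = \<sigma> a * \<sigma> b) \<and>
     (\<forall>a. \<sigma> (const a) = const a)"

text \<open>
  A twelve-tuple \<open>(\<nu>\<^sub>1,\<dots>,\<nu>\<^sub>8; \<kappa>\<^sub>1,\<kappa>\<^sub>2; f,g)\<close> with entries in \<open>K\<close> is a function on \<open>var\<close>;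
  the generic tuple \<open>x\<close> is \<open>X\<close>.
\<close>

type_synonym tuple = "var \<Rightarrow> K"

datatype generator = S0 | S1 | S2 | S3 | S4 | S5 | S6 | S7 | S8

definition s2_numerator :: "tuple \<Rightarrow> K" where
  "s2_numerator y =
     (let \<nu>1 = y Nu1; \<nu>2 = y Nu2; \<kappa>1 = y Kappa1; \<kappa>2 = y Kappa2; f = y F; g = y G in
        \<nu>1 * \<nu>2 * (\<kappa>1 - \<kappa>2) * f * g
        + \<kappa>2 * (\<nu>1 + \<nu>2) * (\<nu>1 * \<nu>2 - \<kappa>1) * f
        - \<kappa>1 * (\<nu>1 + \<nu>2) * (\<nu>1 * \<nu>2 - \<kappa>2) * g
        + (\<kappa>1 - \<kappa>2) * (\<nu>1 * \<nu>2 - \<kappa>1) * (\<nu>1 * \<nu>2 - \<kappa>2))"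

definition s2_denominator :: "tuple \<Rightarrow> K" where
  "s2_denominator y =
     (let \<nu>1 = y Nu1; \<nu>2 = y Nu2; \<kappa>1 = y Kappa1; \<kappa>2 = y Kappa2; f = y F; g = y G in
        \<nu>1 * \<nu>2 * (\<nu>1 * \<nu>2 - \<kappa>2) * f
        - \<nu>1 * \<nu>2 * (\<nu>1 * \<nu>2 - \<kappa>1) * g
        - \<nu>1 * \<nu>2 * (\<nu>1 + \<nu>2) * (\<kappa>1 - \<kappa>2))"

text \<open>
  \<open>R w y\<close> is the tuple of rational expressions defining \<open>w\<close>, with the entries of \<open>y\<close> substituted
  for the variables. Division by zero yields \<open>0\<close>, as usual in HOL.
\<close>

primrec R :: "generator \<Rightarrow> tuple \<Rightarrow> tuple" where
  "R S0 y = y(Nu1 := y Nu2, Nu2 := y Nu1)"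
| "R S1 y = y(Kappa1 := y Kappa2, Kappa2 := y Kappa1, F := y G, G := y F)"
| "R S2 y = y(Nu1 := y Kappa2 / y Nu2,
              Nu2 := y Kappa2 / y Nu1,
              Kappa1 := y Kappa1 * y Kappa2 / (y Nu1 * y Nu2),
              F := s2_numerator y / s2_denominator y)"
| "R S3 y = y(Nu2 := y Nu3, Nu3 := y Nu2)"
| "R S4 y = y(Nu3 := y Nu4, Nu4 := y Nu3)"
| "R S5 y = y(Nu4 := y Nu5, Nu5 := y Nu4)"
| "R S6 y = y(Nu5 := y Nu6, Nu6 := y Nu5)"
| "R S7 y = y(Nu6 := y Nu7, Nu7 := y Nu6)"
| "R S8 y = y(Nu7 := y Nu8, Nu8 := y Nu7)"

text \<open>
  The variables generate \<open>K\<close> as a field over the complex numbers, so at most one automorphism has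
  the prescribed values; one exists because each \<open>R w\<close> is an involution on the generic tuple.
\<close>

definition action :: "generator \<Rightarrow> K \<Rightarrow> K" where
  "action w = (THE \<sigma>. C_algebra_automorphism \<sigma> \<and> (\<forall>v. \<sigma> (X v) = R w X v))"

text \<open>The exponent of the scaling factor on each entry.\<close>

definition weight :: "var \<Rightarrow> nat" where
  "weight v = (if v = Kappa1 \<or> v = Kappa2 then 2 else 1)"

definition equiv_E8 :: "tuple \<Rightarrow> tuple \<Rightarrow> bool" (infix \<open>\<sim>\<close> 50) where
  "y' \<sim> y \<longleftrightarrow> (\<exists>c. c \<noteq> 0 \<and> (\<forall>v. y' v = c ^ weight v * y v))"

end

(*
  The expressions R w are weighted homogeneous (each entry has the weight of the variable that it
  replaces), so R w (x') is R w (x) rescaled by the factor c of x' ~ x. On the other side w sends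
  c ^ k * v to w(c) ^ k * w(v), so that w(x') and R w (x') differ by the rescaling factor w(c) / c.

  That w exists at all rests on R w being an involution on the generic tuple. For s_2 this is the
  fact that f -> N/D is a fractional linear map in f, which the same map after the substitution
  inverts; all that is needed is that certain polynomials do not vanish, and this is seen by
  evaluating them at a numerical point.
*)

theory Submission
  imports Defs
begin

section \<open>Evaluation of polynomials and specialization of fractions\<close>

text \<open>A finitely supported function is the sum of its single terms. The induction serves for
  polynomials and for exponent vectors, which are encoded alike.\<close>

lemma poly_mapping_add_induct [case_names single add]:
  fixes p :: "'k \<Rightarrow>\<^sub>0 'c::comm_monoid_add"
  assumes single: "\<And>k c. P (Poly_Mapping.single k c)"
    and add: "\<And>p q. P p \<Longrightarrow> P q \<Longrightarrow> P (p + q)"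
  shows "P p"
proof -
  have zero: "P 0"
    using single[of undefined 0] by simp
  have sum: "P (\<Sum>k\<in>S. Poly_Mapping.single k (Poly_Mapping.lookup p k))"
    if "finite S" for S
    using that by (induction S rule: finite_induct) (auto intro: zero single add)
  have "p = (\<Sum>k\<in>Poly_Mapping.keys p. Poly_Mapping.single k (Poly_Mapping.lookup p k))"
    by (rule poly_mapping_eqI)
      (simp add: lookup_sum lookup_single when_def in_keys_iff)
  then show ?thesis
    using sum[of "Poly_Mapping.keys p"] by simp
qed

text \<open>The coefficient map \<open>h\<close> is abstract, so that tuples over \<open>K\<close>
  (with \<open>h = const\<close>) and numerical points (with \<open>h = id\<close>) are treated at
  once.\<close>

locale evaluation =
  fixes h :: "'c::idom \<Rightarrow> 'a::field" and y :: "'v::{finite,linorder} \<Rightarrow> 'a"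
  assumes h_add: "h (a + b) = h a + h b"
    and h_mult: "h (a * b) = h a * h b"
    and h_one: "h 1 = 1"
begin

lemma h_zero [simp]: "h 0 = 0"
  using h_add[of 0 0] by (metis add.right_neutral add_left_imp_eq)

definition monom_val :: "('v \<Rightarrow>\<^sub>0 nat) \<Rightarrow> 'a" where
  "monom_val m = (\<Prod>v\<in>UNIV. y v ^ Poly_Mapping.lookup m v)"

definition eval :: "(('v \<Rightarrow>\<^sub>0 nat) \<Rightarrow>\<^sub>0 'c) \<Rightarrow> 'a" where
  "eval p = (\<Sum>m\<in>Poly_Mapping.keys p. h (Poly_Mapping.lookup p m) * monom_val m)"

lemma monom_val_add: "monom_val (m + n) = monom_val m * monom_val n"
  by (simp add: monom_val_def lookup_add power_add prod.distrib)

lemma monom_val_zero [simp]: "monom_val 0 = 1"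
  by (simp add: monom_val_def)

lemma monom_val_single: "monom_val (Poly_Mapping.single v n) = y v ^ n"
proof -
  have "monom_val (Poly_Mapping.single v n) = (\<Prod>u\<in>UNIV. if u = v then y v ^ n else 1)"
    unfolding monom_val_def by (rule prod.cong) (auto simp: lookup_single when_def)
  then show ?thesis by simp
qed

lemma eval_superset:
  assumes "finite S" "Poly_Mapping.keys p \<subseteq> S"
  shows "eval p = (\<Sum>m\<in>S. h (Poly_Mapping.lookup p m) * monom_val m)"
  unfolding eval_def using assms
  by (intro sum.mono_neutral_left) (auto simp: in_keys_iff)

lemma eval_single: "eval (Poly_Mapping.single m c) = h c * monom_val m"
  by (subst eval_superset[of "{m}"]) auto

lemma eval_add: "eval (p + q) = eval p + eval q"
proof -
  let ?S = "Poly_Mapping.keys p \<union> Poly_Mapping.keys q"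
  have "eval (p + q) = (\<Sum>m\<in>?S. h (Poly_Mapping.lookup (p + q) m) * monom_val m)"
    by (intro eval_superset) (auto dest: subsetD[OF Poly_Mapping.keys_add])
  also have "\<dots> = eval p + eval q"
    by (simp add: eval_superset[of ?S] lookup_add h_add distrib_right sum.distrib)
  finally show ?thesis .
qed

text \<open>Both sides are additive in each factor, so it suffices to compare products of single
  terms.\<close>

lemma eval_mult: "eval (p * q) = eval p * eval q"
proof (induction p rule: poly_mapping_add_induct)
  case (single m c)
  show ?case
    by (induction q rule: poly_mapping_add_induct)
      (simp_all add: mult_single eval_single eval_add h_mult monom_val_add algebra_simps)
qed (simp add: eval_add algebra_simps)

lemma eval_zero [simp]: "eval 0 = 0"
  by (simp add: eval_def)

lemma eval_one [simp]: "eval 1 = 1"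
  using eval_single[of 0 1] by (simp add: h_one)

lemma eval_uminus: "eval (- p) = - eval p"
  using eval_add[of p "- p"] by (simp add: eq_neg_iff_add_eq_0 add.commute)

text \<open>
  The graph of the extension of \<^const>\<open>eval\<close> to fractions; it is partial, being defined only on
  fractions with some denominator that does not evaluate to zero.
\<close>

definition specializes :: "(('v \<Rightarrow>\<^sub>0 nat) \<Rightarrow>\<^sub>0 'c) fract \<Rightarrow> 'a \<Rightarrow> bool" where
  "specializes k r \<longleftrightarrow> (\<exists>a b. k = Fract a b \<and> eval b \<noteq> 0 \<and> r = eval a / eval b)"

lemma specializes_Fract: "eval b \<noteq> 0 \<Longrightarrow> specializes (Fract a b) (eval a / eval b)"
  by (auto simp: specializes_def)

lemma specializesE:
  assumes "specializes k r"
  obtains a b where "k = Fract a b" "b \<noteq> 0" "eval b \<noteq> 0" "r = eval a / eval b"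
  using assms eval_zero unfolding specializes_def by metis

text \<open>Equality of fractions is the polynomial identity \<open>a * d = c * b\<close>, which
  evaluation preserves; the denominators do not evaluate to zero.\<close>

lemma specializes_unique:
  assumes "specializes k r" "specializes k s"
  shows "r = s"
proof -
  obtain a b where ab: "k = Fract a b" "b \<noteq> 0" "eval b \<noteq> 0" "r = eval a / eval b"
    using assms(1) by (rule specializesE)
  obtain c d where cd: "k = Fract c d" "d \<noteq> 0" "eval d \<noteq> 0" "s = eval c / eval d"
    using assms(2) by (rule specializesE)
  have "a * d = c * b"
    using ab cd by (simp add: eq_fract)
  then have "eval a * eval d = eval c * eval b"
    by (metis eval_mult)
  then show ?thesis
    using ab cd by (simp add: frac_eq_eq)
qed

lemma specializes_poly: "specializes (Fract p 1) (eval p)"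
  using specializes_Fract[of 1 p] by simp

lemma specializes_const: "specializes (Fract (Poly_Mapping.single 0 c) 1) (h c)"
  using specializes_poly[of "Poly_Mapping.single 0 c"] by (simp add: eval_single)

lemma specializes_var:
  "specializes (Fract (Poly_Mapping.single (Poly_Mapping.single v 1) 1) 1) (y v)"
  using specializes_poly[of "Poly_Mapping.single (Poly_Mapping.single v 1) 1"]
  by (simp add: eval_single monom_val_single h_one)

lemma specializes_zero: "specializes 0 0"
  using specializes_poly[of 0] by (simp add: fract_collapse)

lemma specializes_one: "specializes 1 1"
  using specializes_poly[of 1] by (simp add: fract_collapse)

lemma specializes_add:
  assumes "specializes k r" "specializes l s"
  shows "specializes (k + l) (r + s)"
proof -
  obtain a b where ab: "k = Fract a b" "b \<noteq> 0" "eval b \<noteq> 0" "r = eval a / eval b"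
    using assms(1) by (rule specializesE)
  obtain c d where cd: "l = Fract c d" "d \<noteq> 0" "eval d \<noteq> 0" "s = eval c / eval d"
    using assms(2) by (rule specializesE)
  have "r + s = eval (a * d + c * b) / eval (b * d)"
    using ab cd by (simp add: eval_add eval_mult add_frac_eq)
  then show ?thesis
    using specializes_Fract[of "b * d" "a * d + c * b"] ab cd by (simp add: eval_mult)
qed

lemma specializes_mult:
  assumes "specializes k r" "specializes l s"
  shows "specializes (k * l) (r * s)"
proof -
  obtain a b where ab: "k = Fract a b" "eval b \<noteq> 0" "r = eval a / eval b"
    using assms(1) by (rule specializesE)
  obtain c d where cd: "l = Fract c d" "eval d \<noteq> 0" "s = eval c / eval d"
    using assms(2) by (rule specializesE)
  show ?thesis
    using specializes_Fract[of "b * d" "a * c"] ab cd by (simp add: eval_mult)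
qed

lemma specializes_uminus:
  assumes "specializes k r"
  shows "specializes (- k) (- r)"
proof -
  obtain a b where ab: "k = Fract a b" "eval b \<noteq> 0" "r = eval a / eval b"
    using assms by (rule specializesE)
  then show ?thesis
    using specializes_Fract[of b "- a"] by (simp add: eval_uminus)
qed

lemma specializes_diff:
  "specializes k r \<Longrightarrow> specializes l s \<Longrightarrow> specializes (k - l) (r - s)"
  using specializes_add[of k r "- l" "- s"] specializes_uminus by simp

lemma specializes_inverse:
  assumes "specializes k r" "r \<noteq> 0"
  shows "specializes (inverse k) (inverse r)"
proof -
  obtain a b where ab: "k = Fract a b" "eval b \<noteq> 0" "r = eval a / eval b"
    using assms(1) by (rule specializesE)
  then show ?thesis
    using specializes_Fract[of a b] assms(2) by simp
qed

lemma specializes_divide: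
  "specializes k r \<Longrightarrow> specializes l s \<Longrightarrow> s \<noteq> 0 \<Longrightarrow> specializes (k / l) (r / s)"
  unfolding divide_inverse by (intro specializes_mult specializes_inverse)

lemma specializes_power: "specializes k r \<Longrightarrow> specializes (k ^ n) (r ^ n)"
  by (induction n) (auto intro: specializes_one specializes_mult)

lemma specializes_sum:
  "(\<And>i. i \<in> S \<Longrightarrow> specializes (k i) (r i)) \<Longrightarrow> specializes (sum k S) (sum r S)"
  by (induction S rule: infinite_finite_induct) (auto intro: specializes_zero specializes_add)

lemma specializes_prod:
  "(\<And>i. i \<in> S \<Longrightarrow> specializes (k i) (r i)) \<Longrightarrow> specializes (prod k S) (prod r S)"
  by (induction S rule: infinite_finite_induct) (auto intro: specializes_one specializes_mult)

text \<open>\<open>0\<close> specializes only to \<open>0\<close>, so one nonzero value is a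
  certificate.\<close>

lemma specializes_nonzero: "specializes k r \<Longrightarrow> r \<noteq> 0 \<Longrightarrow> k \<noteq> 0"
  using specializes_unique specializes_zero by blast

end

section \<open>The generic tuple over \<open>K\<close>\<close>

instance var :: finite
proof
  have "(UNIV :: var set) \<subseteq> {Nu1, Nu2, Nu3, Nu4, Nu5, Nu6, Nu7, Nu8, Kappa1, Kappa2, F, G}"
    by (auto intro: var.exhaust)
  then show "finite (UNIV :: var set)"
    by (rule finite_subset) simp
qed

text \<open>The tuple \<open>y\<close> stays a parameter: \<open>gen.eval y\<close> substitutes
  \<open>y\<close> for the variables.\<close>

interpretation gen: evaluation const y for y :: tuple
  by standard (simp_all add: const_def mult_single single_add fract_collapse)

lemma monom_val_X: "gen.monom_val X m = Fract (Poly_Mapping.single m 1) 1"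
proof (induction m rule: poly_mapping_add_induct)
  case (single v n)
  show ?case
  proof (induction n)
    case (Suc n)
    have "Poly_Mapping.single v (Suc n) = Poly_Mapping.single v 1 + Poly_Mapping.single v n"
      by (simp flip: single_add)
    then have "Fract (Poly_Mapping.single (Poly_Mapping.single v (Suc n)) 1) 1 =
        X v * Fract (Poly_Mapping.single (Poly_Mapping.single v n) (1 :: complex)) 1"
      by (simp add: X_def mult_single)
    then show ?case
      using Suc by (simp add: gen.monom_val_single)
  qed (simp add: fract_collapse)
next
  case (add m n)
  then show ?case
    by (simp add: gen.monom_val_add mult_single)
qed

lemma eval_X: "gen.eval X p = Fract p 1"
proof (induction p rule: poly_mapping_add_induct)
  case (single m c)
  have "const c * Fract (Poly_Mapping.single m 1) 1 = Fract (Poly_Mapping.single m c) 1"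
    by (simp add: const_def mult_single)
  then show ?case
    by (simp add: gen.eval_single monom_val_X)
qed (simp add: gen.eval_add)

lemma X_nonzero: "X v \<noteq> 0"
proof -
  have "Poly_Mapping.single (Poly_Mapping.single v 1) (1 :: complex) \<noteq> 0"
    by (metis lookup_single_eq lookup_zero one_neq_zero)
  then show ?thesis
    unfolding X_def by (simp add: Zero_fract_def eq_fract del: One_nat_def)
qed

section \<open>Automorphisms of \<open>K\<close> as substitutions\<close>

lemma C_algebra_automorphism_hom:
  assumes "C_algebra_automorphism \<sigma>"
  shows "\<sigma> (a + b) = \<sigma> a + \<sigma> b" "\<sigma> (a * b) = \<sigma> a * \<sigma> b" "\<sigma> (const c) = const c"
    "\<sigma> 0 = 0" "\<sigma> 1 = 1" "\<sigma> (a ^ n) = \<sigma> a ^ n" "\<sigma> (inverse a) = inverse (\<sigma> a)"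
    "\<sigma> (a / b) = \<sigma> a / \<sigma> b" "\<sigma> a = 0 \<longleftrightarrow> a = 0"
proof -
  note * = assms[unfolded C_algebra_automorphism_def]
  show add: "\<sigma> (a + b) = \<sigma> a + \<sigma> b" for a b using * by blast
  show mult: "\<sigma> (a * b) = \<sigma> a * \<sigma> b" for a b using * by blast
  show const: "\<sigma> (const c) = const c" for c using * by blast
  show zero: "\<sigma> 0 = 0" using add[of 0 0] by (metis add.right_neutral add_left_imp_eq)
  show one: "\<sigma> 1 = 1" using const[of 1] by (simp add: gen.h_one)
  show "\<sigma> (a ^ n) = \<sigma> a ^ n" by (induction n) (simp_all add: one mult)
  show inverse: "\<sigma> (inverse a) = inverse (\<sigma> a)" for a
  proof (cases "a = 0")
    case False
    then have "\<sigma> a * \<sigma> (inverse a) = 1"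
      using mult[of a "inverse a"] one by simp
    then show ?thesis
      by (rule inverse_unique[symmetric])
  qed (simp add: zero)
  show "\<sigma> (a / b) = \<sigma> a / \<sigma> b" by (simp add: divide_inverse mult inverse)
  show "\<sigma> a = 0 \<longleftrightarrow> a = 0"
    using * zero by (metis bij_pointE)
qed

text \<open>An automorphism respects sums and products and fixes constants, so it acts by
  substituting the images of the variables; hence those images determine it.\<close>

lemma automorphism_Fract:
  assumes "C_algebra_automorphism \<sigma>"
  shows "\<sigma> (Fract a b) = gen.eval (\<lambda>v. \<sigma> (X v)) a / gen.eval (\<lambda>v. \<sigma> (X v)) b"
proof -
  note hom = C_algebra_automorphism_hom[OF assms]
  let ?y = "\<lambda>v. \<sigma> (X v)"
  have prod: "\<sigma> (prod k S) = (\<Prod>i\<in>S. \<sigma> (k i))" for k and S :: "var set"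
    by (induction S rule: infinite_finite_induct) (simp_all add: hom)
  have "\<sigma> (Fract p 1) = gen.eval ?y p" for p
  proof (induction p rule: poly_mapping_add_induct)
    case (single m c)
    then show ?case
      by (simp add: eval_X[symmetric] gen.eval_single gen.monom_val_def hom prod)
  next
    case (add p q)
    have "Fract (p + q) 1 = Fract p 1 + Fract q 1" by simp
    then show ?case using add by (simp only: hom gen.eval_add)
  qed
  \<comment> \<open>This covers \<open>b = 0\<close>, where both sides are \<open>0\<close> by
    convention.\<close>
  moreover have "Fract a b = Fract a 1 / Fract b 1" by simp
  ultimately show ?thesis by (simp only: hom)
qed

lemma automorphism_unique:
  assumes "C_algebra_automorphism \<sigma>" "C_algebra_automorphism \<tau>" "\<And>v. \<sigma> (X v) = \<tau> (X v)"
  shows "\<sigma> = \<tau>"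
proof
  fix k
  show "\<sigma> k = \<tau> k"
    by (cases k) (simp add: automorphism_Fract[OF assms(1)] automorphism_Fract[OF assms(2)] assms(3))
qed

text \<open>Composition of substitutions: the value at \<open>z\<close> is built from constants and
  the \<open>z v\<close> by sums and products, which \<open>specializes\<close> respects.\<close>

lemma specializes_eval:
  assumes "\<And>v. gen.specializes y (z v) (u v)"
  shows "gen.specializes y (gen.eval z p) (gen.eval u p)"
proof -
  have "gen.specializes y (const c) (const c)" for c
    using gen.specializes_const[of y c] by (simp only: const_def)
  then show ?thesis
    unfolding gen.eval_def gen.monom_val_def
    by (intro gen.specializes_sum gen.specializes_mult gen.specializes_prod gen.specializes_power
        assms)
qed

text \<open>
  If substituting \<open>y\<close> for the variables twice returns the variables, then substituting \<open>y\<close> into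
  the value at \<open>y\<close> of a polynomial recovers that polynomial; hence evaluation at \<open>y\<close> is injective
  and extends to all of \<open>K\<close>.
\<close>

lemma involution_automorphism:
  assumes invol: "\<And>v. gen.specializes y (y v) (X v)"
  shows "\<exists>\<sigma>. C_algebra_automorphism \<sigma> \<and> (\<forall>v. \<sigma> (X v) = y v)"
proof -
  \<comment> \<open>The value is unique by \<open>specializes_unique\<close>; it exists for every
    \<open>k\<close> once \<open>nonzero\<close> is known.\<close>
  define \<sigma> where "\<sigma> k = (THE r. gen.specializes y k r)" for k
  have twice: "gen.specializes y (gen.eval y p) (Fract p 1)" for p
    using specializes_eval[of y y X p] invol by (simp add: eval_X)
  have nonzero: "gen.eval y p \<noteq> 0" if "p \<noteq> 0" for p
  proof
    assume "gen.eval y p = 0"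
    then have "Fract p 1 = 0"
      using twice[of p] gen.specializes_unique gen.specializes_zero by metis
    then show False
      using that by (simp add: Zero_fract_def eq_fract)
  qed
  have eq: "\<sigma> k = r" if "gen.specializes y k r" for k r
    unfolding \<sigma>_def using that by (blast intro: gen.specializes_unique)
  have \<sigma>: "gen.specializes y k (\<sigma> k)" for k
  proof (cases k)
    case (Fract a b)
    then show ?thesis
      using gen.specializes_Fract[OF nonzero, of b a] eq by metis
  qed
  \<comment> \<open>Bijectivity: \<sigma> is its own inverse, because \<open>twice\<close> undoes
    the substitution in numerator and denominator.\<close>
  have "\<sigma> (\<sigma> k) = k" for k
  proof (cases k)
    case (Fract a b)
    have "\<sigma> k = gen.eval y a / gen.eval y b"
      using Fract by (intro eq) (simp add: gen.specializes_Fract nonzero)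
    moreover have "Fract b 1 \<noteq> 0"
      using Fract by (simp add: Zero_fract_def eq_fract)
    ultimately have "gen.specializes y (\<sigma> k) (Fract a 1 / Fract b 1)"
      using gen.specializes_divide[OF twice twice] by metis
    then show ?thesis
      using Fract eq by simp
  qed
  then have "bij \<sigma>"
    by (rule involuntory_imp_bij)
  moreover have "\<sigma> (a + b) = \<sigma> a + \<sigma> b" "\<sigma> (a * b) = \<sigma> a * \<sigma> b" for a b
    by (intro eq gen.specializes_add gen.specializes_mult \<sigma>)+
  moreover have "\<sigma> (const c) = const c" for c
    using gen.specializes_const[of y c] by (intro eq) (simp add: const_def)
  moreover have "\<sigma> (X v) = y v" for v
    using gen.specializes_var[of y v] by (intro eq) (simp add: X_def)
  ultimately show ?thesis
    unfolding C_algebra_automorphism_def by blast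
qed

section \<open>The generator s_2 as an involution\<close>

text \<open>The first is the divisor in the image of \<open>f\<close>; the others are the
  non-monomial factors of the determinant \<open>E\<close> in the involution proof below.\<close>

lemma s2_generic_nonzero:
  "s2_denominator X \<noteq> 0" "X Kappa1 \<noteq> X Kappa2" "X Nu1 * X Nu2 \<noteq> X Kappa1"
    "X Nu1 * X G - X Nu1 * X Nu1 - X Kappa2 \<noteq> 0"
    "X Nu2 * X G - X Nu2 * X Nu2 - X Kappa2 \<noteq> 0"
proof -
  \<comment> \<open>Any point where none of the five factors vanishes serves; here their values are
    -2, -1, -1, -4, -4.\<close>
  define pt :: "var \<Rightarrow> complex"
    where "pt = (\<lambda>_. 1)(Kappa1 := 2, Kappa2 := 3, F := 2, G := 0)"
  interpret pt: evaluation id pt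
    by standard simp_all
  have X: "pt.specializes (X v) (pt v)" for v
    unfolding X_def by (rule pt.specializes_var)
  note intros = pt.specializes_add pt.specializes_diff pt.specializes_mult X
  let ?k = "s2_denominator X * (X Kappa1 - X Kappa2) * (X Nu1 * X Nu2 - X Kappa1) *
    (X Nu1 * X G - X Nu1 * X Nu1 - X Kappa2) * (X Nu2 * X G - X Nu2 * X Nu2 - X Kappa2)"
  have "\<exists>r. pt.specializes ?k r \<and> r \<noteq> 0"
    unfolding s2_denominator_def Let_def
    \<comment> \<open>The introduction rules build the value \<open>r\<close> by
      unification.\<close>
    by (rule exI, rule conjI, (rule intros)+) (simp add: pt_def)
  then have "?k \<noteq> 0"
    using pt.specializes_nonzero by blast
  then show "s2_denominator X \<noteq> 0" "X Kappa1 \<noteq> X Kappa2" "X Nu1 * X Nu2 \<noteq> X Kappa1"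
    "X Nu1 * X G - X Nu1 * X Nu1 - X Kappa2 \<noteq> 0"
    "X Nu2 * X G - X Nu2 * X Nu2 - X Kappa2 \<noteq> 0"
    by auto
qed

text \<open>Multiplied by \<open>d\<close>, the second denominator and numerator become
  \<open>E\<close> and \<open>f * E\<close>, with \<open>E\<close> free of \<open>f\<close>, so
  their quotient is \<open>f\<close>. The entries \<open>Nu1\<close>, \<open>Nu2\<close>,
  \<open>Kappa1\<close> are multiplied by \<open>t\<close> in the first application and by
  \<open>1 / t\<close> in the second.\<close>

lemma R_S2_involutive: "R S2 (R S2 X) = X"
  and s2_denominator_R_S2_nonzero: "s2_denominator (R S2 X) \<noteq> 0"
proof -
  define a b k l f g where "a = X Nu1" "b = X Nu2" "k = X Kappa1" "l = X Kappa2" "f = X F" "g = X G"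
  define n d where "n = s2_numerator X" and "d = s2_denominator X"
  \<comment> \<open>In terms of \<open>t\<close> instead of \<open>\<kappa>\<^sub>2\<close> all entries of \<open>R S2 X\<close> but \<open>f\<close> are polynomial.\<close>
  define t where "t = l / (a * b)"
  \<comment> \<open>Up to a factor, the determinant of the fractional linear map \<open>f \<mapsto> n / d\<close>.\<close>
  define E where "E = - (t ^ 3 * a * b * (k - l) * (a * b - k) * (a * g - a * a - l) * (b * g - b * b - l))"
  note defs = a_b_k_l_f_g_def
  have nz: "a \<noteq> 0" "b \<noteq> 0" "k \<noteq> 0" "l \<noteq> 0" "d \<noteq> 0" "E \<noteq> 0"
    using s2_generic_nonzero by (auto simp: defs d_def E_def t_def X_nonzero)
  have l: "l = t * a * b"
    using nz(1,2) by (simp add: t_def)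
  have n: "n = a * b * (k - l) * f * g + l * (a + b) * (a * b - k) * f
      - k * (a + b) * (a * b - l) * g + (k - l) * (a * b - k) * (a * b - l)"
    by (simp add: n_def s2_numerator_def defs Let_def)
  have d: "d = a * b * (a * b - l) * f - a * b * (a * b - k) * g - a * b * (a + b) * (k - l)"
    by (simp add: d_def s2_denominator_def defs Let_def)
  define \<phi> where "\<phi> = n / d"
  have R: "R S2 X = X(Nu1 := t * a, Nu2 := t * b, Kappa1 := k * t, F := \<phi>)"
    using nz(1,2) by (simp add: defs n_def d_def \<phi>_def t_def)
  have \<phi>: "\<phi> * d = n"
    using nz by (simp add: \<phi>_def)
  \<comment> \<open>Clearing \<phi> by \<open>\<phi> * d = n\<close> leaves polynomial
    identities.\<close>
  have D_aux: "(A * \<phi> - B - C) * d = A * n - B * d - C * d" for A B C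
    by (simp add: \<phi>[symmetric] algebra_simps)
  have N_aux: "(A * \<phi> * g + B * \<phi> - C + D) * d = A * n * g + B * n - C * d + D * d" for A B C D
    by (simp add: \<phi>[symmetric] algebra_simps)
  let ?D = "s2_denominator (R S2 X)" and ?N = "s2_numerator (R S2 X)"
  have "?D = (t * a) * (t * b) * ((t * a) * (t * b) - l) * \<phi>
      - (t * a) * (t * b) * ((t * a) * (t * b) - k * t) * g
      - (t * a) * (t * b) * (t * a + t * b) * (k * t - l)"
    unfolding R by (simp add: s2_denominator_def defs Let_def)
  then have "?D * d = (t * a) * (t * b) * ((t * a) * (t * b) - l) * n
      - (t * a) * (t * b) * ((t * a) * (t * b) - k * t) * g * d
      - (t * a) * (t * b) * (t * a + t * b) * (k * t - l) * d"
    by (simp only: D_aux)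
  \<comment> \<open>With \<open>l = t * a * b\<close> substituted, the terms in \<open>f\<close>
    cancel identically.\<close>
  also have "\<dots> = E"
    unfolding n d E_def l by algebra
  finally have D: "?D * d = E" .
  have "?N = (t * a) * (t * b) * (k * t - l) * \<phi> * g
      + l * (t * a + t * b) * ((t * a) * (t * b) - k * t) * \<phi>
      - k * t * (t * a + t * b) * ((t * a) * (t * b) - l) * g
      + (k * t - l) * ((t * a) * (t * b) - k * t) * ((t * a) * (t * b) - l)"
    unfolding R by (simp add: s2_numerator_def defs Let_def)
  then have "?N * d = (t * a) * (t * b) * (k * t - l) * n * g
      + l * (t * a + t * b) * ((t * a) * (t * b) - k * t) * n
      - k * t * (t * a + t * b) * ((t * a) * (t * b) - l) * g * d
      + (k * t - l) * ((t * a) * (t * b) - k * t) * ((t * a) * (t * b) - l) * d"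
    by (simp only: N_aux)
  also have "\<dots> = f * E"
    unfolding n d E_def l by algebra
  finally have N: "?N * d = f * E" .
  show D_nz: "?D \<noteq> 0"
    using D nz by auto
  have "?N * d = f * ?D * d"
    by (simp only: N D mult.assoc)
  then have "?N = f * ?D"
    using mult_right_cancel[OF nz(5)] by blast
  then have "?N / ?D = f"
    using D_nz by (simp only: nonzero_mult_div_cancel_right not_False_eq_True)
  \<comment> \<open>The name \<open>y\<close> keeps the inner \<open>R S2 X\<close> folded while the
    outer \<open>R S2\<close> is expanded.\<close>
  define y where "y = R S2 X"
  have y: "y Nu1 = t * a" "y Nu2 = t * b" "y Kappa1 = k * t" "y Kappa2 = l"
    "s2_numerator y / s2_denominator y = f"
    "v \<notin> {Nu1, Nu2, Kappa1, F} \<Longrightarrow> y v = X v" for v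
    using \<open>?N / ?D = f\<close> unfolding y_def by (simp_all add: R defs del: R.simps)
  have "t \<noteq> 0"
    using nz l by auto
  then have "l / (t * b) = a" "l / (t * a) = b" "k * t * l / (t * a * (t * b)) = k"
    using nz(1,2) by (simp_all add: l)
  then have "R S2 y v = X v" for v
    by (cases v) (simp_all only: R.simps fun_upd_apply y, simp_all add: y defs)
  then show "R S2 (R S2 X) = X"
    unfolding y_def by blast
qed

section \<open>Substitution into \<open>R\<close> and its weighted homogeneity\<close>

text \<open>Only \<open>S2\<close> divides, and its divisors are products of the three quantities
  assumed nonzero.\<close>

lemma R_specializes:
  assumes "w = S2 \<Longrightarrow> y Nu1 \<noteq> 0 \<and> y Nu2 \<noteq> 0 \<and> s2_denominator y \<noteq> 0"
  shows "gen.specializes y (R w X v) (R w y v)"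
proof -
  have X: "gen.specializes y (X v) (y v)" for v
    unfolding X_def by (rule gen.specializes_var)
  note intros = gen.specializes_add gen.specializes_diff gen.specializes_mult X
  have num: "gen.specializes y (s2_numerator X) (s2_numerator y)"
    unfolding s2_numerator_def Let_def by (intro intros)
  have den: "gen.specializes y (s2_denominator X) (s2_denominator y)"
    unfolding s2_denominator_def Let_def by (intro intros)
  show ?thesis
    using assms
    by (cases w) (auto intro!: gen.specializes_divide gen.specializes_mult num den X)
qed

text \<open>Every term has weight 6, each \<kappa> counting twice; against weight 5 for the
  denominator, the quotient has the weight 1 of \<open>f\<close>.\<close>

lemma s2_numerator_scale:
  assumes "\<And>v. y v = c ^ weight v * z v"
  shows "s2_numerator y = c ^ 6 * s2_numerator z"
  unfolding s2_numerator_def Let_def assms weight_def by simp algebra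

lemma s2_denominator_scale:
  assumes "\<And>v. y v = c ^ weight v * z v"
  shows "s2_denominator y = c ^ 5 * s2_denominator z"
  unfolding s2_denominator_def Let_def assms weight_def by simp algebra

text \<open>The scaling agrees with the convention for division by zero: a divisor vanishing at
  \<open>z\<close> vanishes at \<open>y\<close>, and both sides are \<open>0\<close>.\<close>

lemma R_scale:
  assumes "c \<noteq> 0" "\<And>v. y v = c ^ weight v * z v"
  shows "R w y v = c ^ weight v * R w z v"
proof (cases "w = S2")
  case True
  have "c ^ 6 = c * c ^ 5"
    by (simp add: eval_nat_numeral)
  then show ?thesis
    using assms(1)
    by (simp add: True s2_numerator_scale[OF assms(2)] s2_denominator_scale[OF assms(2)] assms(2)
        weight_def power2_eq_square)
next
  case False
  then show ?thesis
    by (cases w) (simp_all add: assms(2) weight_def)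
qed

section \<open>The action of the generators\<close>

text \<open>Justifies the definite description: existence comes from
  \<open>involution_automorphism\<close>, uniqueness from
  \<open>automorphism_unique\<close>.\<close>

lemma action_automorphism: "C_algebra_automorphism (action w)"
  and action_X: "action w (X v) = R w X v"
proof -
  obtain \<sigma> where \<sigma>: "C_algebra_automorphism \<sigma> \<and> (\<forall>v. \<sigma> (X v) = R w X v)"
  proof -
    let ?y = "R w X"
    have "R w ?y = X"
      by (cases "w = S2") (simp add: R_S2_involutive del: R.simps, cases w, auto)
    \<comment> \<open>Since \<open>R w ?y = X\<close>, this is the premise of
      \<open>involution_automorphism\<close>.\<close>
    moreover have "gen.specializes ?y (R w X v) (R w ?y v)" for v
    proof (rule R_specializes)
      assume "w = S2"
      then show "?y Nu1 \<noteq> 0 \<and> ?y Nu2 \<noteq> 0 \<and> s2_denominator ?y \<noteq> 0"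
        using s2_denominator_R_S2_nonzero X_nonzero by auto
    qed
    ultimately show thesis
      using involution_automorphism[of ?y] that by auto
  qed
  then have "C_algebra_automorphism (action w) \<and> (\<forall>v. action w (X v) = R w X v)"
    unfolding action_def
    by (rule theI[where P = "\<lambda>\<sigma>. C_algebra_automorphism \<sigma> \<and> (\<forall>v. \<sigma> (X v) = R w X v)"])
      (metis \<sigma> automorphism_unique)
  then show "C_algebra_automorphism (action w)" "action w (X v) = R w X v"
    by auto
qed

theorem theorem3p7:
  fixes x' :: tuple and w :: generator
  assumes "x' \<sim> X"
  shows "(\<lambda>v. action w (x' v)) \<sim> R w x'"
proof -
  obtain c where c: "c \<noteq> 0" "\<And>v. x' v = c ^ weight v * X v"
    using assms unfolding equiv_E8_def by blast
  note hom = C_algebra_automorphism_hom[OF action_automorphism[of w]]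
  \<comment> \<open>\<open>c\<close> is an element of \<open>K\<close>, so \<open>action w\<close>
    applies to it too; hence the quotient as the new scalar.\<close>
  have "action w (x' v) = (action w c / c) ^ weight v * R w x' v" for v
    using c(1) by (simp add: R_scale[OF c] c(2) hom action_X power_divide)
  moreover have "action w c / c \<noteq> 0"
    using c(1) by (simp add: hom)
  ultimately show ?thesis
    unfolding equiv_E8_def by blast
qed

end
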